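(* (i) Let $G_1$ and $G_2$ be two star-convex graphs (whose weight functions agree on common vertices) such that both $V_{\ell}(G_1\cap G_2)$ and $V_{\ell}(G_1\cup G_2)$ are non-empty. If $C(G_1)\cap C(G_2)$ is non-empty, then $G_1\cup G_2$ is star-convex. (ii) If $G_1$ and $G_2$ are two star-convex graphs (whose weight functions agree on common vertices) such that $V_{\ell}(G_1\cap G_2)$, $V_{\ell}(G_1\cup G_2)$ and $C(G_1)\cap C(G_2)$ are all non-empty, then $G_1\cap G_2$ need not be star-convex: there exist star-convex graphs $G_1$ and $G_2$ (whose weight functions agree on common vertices) such that $V_{\ell}(G_1\cap G_2)$, $V_{\ell}(G_1\cup G_2)$ and $C(G_1)\cap C(G_2)$ are all non-empty, but $G_1\cap G_2$ is not star-convex.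
   Context: All graphs are finite. A weighted graph $G(V,E,w)$ is a simple connected graph with vertex set $V$, edge set $E$ and a vertex-weight function $w:V\to\mathbb{R}_{+}$, where $\mathbb{R}_+$ is the set of non-negative reals. $V_{\ell}(G)$ denotes the set of vertices of $G$ of degree exactly $1$ in $G$. A path $x_0,x_1,\dots,x_k$ is weighted-monotone if $w(x_0)\le w(x_1)\le\cdots\le w(x_k)$ or $w(x_0)\ge w(x_1)\ge\cdots\ge w(x_k)$ (a one-vertex path is trivially weighted-monotone). A weighted graph with non-empty $V_{\ell}$ is star-convex if there exists a vertex $u\in V$ such that for every $v\in V_{\ell}$ there is a weighted-monotone path in the graph connecting $u$ and $v$. The set of all such vertices $u$ is the core $C(G)$. The union $G_1\cup G_2$ (intersection $G_1\cap G_2$) is the graph whose vertex set and edge set are the unions (intersections) of the vertex sets and edge sets of $G_1$ and $G_2$, with the common weights. *)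

theory Defs
  imports Complex_Main "Graph_Theory.Graph_Theory"
begin

text \<open>
  A finite simple graph is a \<^locale>\<open>pair_graph\<close>: every edge is represented by its two
  opposite arcs, so the degree of a vertex is its out-degree.  The weight function is total in
  the logic; only its values on the vertices of the graph are meaningful.
\<close>

record 'a weighted_graph =
  graph_of :: "'a pair_pre_digraph"
  weight :: "'a \<Rightarrow> real"

definition weighted_graph :: "'a weighted_graph \<Rightarrow> bool" where
  "weighted_graph G \<longleftrightarrow> pair_graph (graph_of G) \<and> connected (with_proj (graph_of G)) \<and>
     (\<forall>v \<in> pverts (graph_of G). 0 \<le> weight G v)"

definition leaves :: "'a weighted_graph \<Rightarrow> 'a set" where
  "leaves G = {v \<in> pverts (graph_of G). out_degree (with_proj (graph_of G)) v = 1}"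

definition weighted_monotone :: "('a \<Rightarrow> real) \<Rightarrow> 'a list \<Rightarrow> bool" where
  "weighted_monotone w p \<longleftrightarrow> sorted_wrt (\<le>) (map w p) \<or> sorted_wrt (\<ge>) (map w p)"

definition core :: "'a weighted_graph \<Rightarrow> 'a set" where
  "core G = {u \<in> pverts (graph_of G). \<forall>v \<in> leaves G. \<exists>p.
     vpath p (with_proj (graph_of G)) \<and> hd p = u \<and> last p = v \<and> weighted_monotone (weight G) p}"

definition star_convex :: "'a weighted_graph \<Rightarrow> bool" where
  "star_convex G \<longleftrightarrow> weighted_graph G \<and> leaves G \<noteq> {} \<and> core G \<noteq> {}"

definition weights_agree :: "'a weighted_graph \<Rightarrow> 'a weighted_graph \<Rightarrow> bool" where
  "weights_agree G H \<longleftrightarrow>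
     (\<forall>v \<in> pverts (graph_of G) \<inter> pverts (graph_of H). weight G v = weight H v)"

text \<open>The weights of the next two graphs are the common ones only under \<^const>\<open>weights_agree\<close>.\<close>

definition graph_union :: "'a weighted_graph \<Rightarrow> 'a weighted_graph \<Rightarrow> 'a weighted_graph" where
  "graph_union G H =
     \<lparr> graph_of = \<lparr> pverts = pverts (graph_of G) \<union> pverts (graph_of H),
                    parcs = parcs (graph_of G) \<union> parcs (graph_of H) \<rparr>,
       weight = (\<lambda>v. if v \<in> pverts (graph_of G) then weight G v else weight H v) \<rparr>"

definition graph_inter :: "'a weighted_graph \<Rightarrow> 'a weighted_graph \<Rightarrow> 'a weighted_graph" where
  "graph_inter G H =
     \<lparr> graph_of = \<lparr> pverts = pverts (graph_of G) \<inter> pverts (graph_of H),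
                    parcs = parcs (graph_of G) \<inter> parcs (graph_of H) \<rparr>,
       weight = weight G \<rparr>"

end

theory Submission
  imports Defs
begin

text \<open>
  \<^bold>\<open>Unions.\<close>  Take \<open>u\<close> in both cores.  A leaf \<open>v\<close> of the union lies in one of the two graphs, say in
  \<open>G1\<close>, and passing to a subgraph cannot raise its degree, so its degree in \<open>G1\<close> is at most 1.
  Degree 0 would make the connected graph \<open>G1\<close> a single vertex, and then \<open>G1\<close> would have no leaf
  at all.  So \<open>v\<close> is a leaf of \<open>G1\<close>, and the monotone path from \<open>u\<close> to \<open>v\<close> in \<open>G1\<close> is also one in
  the union, where the vertices of \<open>G1\<close> keep their weights (\<open>core_inter_subset_core_union\<close>).
  The union is connected because both parts contain \<open>u\<close>.

  \<^bold>\<open>Intersections.\<close>  Give the path \<open>0 - 1 - 2 - 3\<close> the weights 0, 1, 0, 1.  Weights change along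
  every edge and take two values only, so a monotone walk has at most one edge; as the leaves 0
  and 3 are at distance 3, no vertex reaches both of them
  (\<open>not_star_convex_zigzag\<close>).  Adding the chord \<open>1 - 3\<close> on the one
  hand, and a new vertex 4 joined to 2 and 3 on the other, turns 3 into a non-leaf in two
  different ways.  In each of the two resulting graphs 0 is the only leaf, so 0 lies in the core by
  the one-vertex path, while the intersection is the original path.
\<close>

section \<open>Weighted graphs in terms of vertex sets and arc relations\<close>

abbreviation V :: "'a weighted_graph \<Rightarrow> 'a set" where
  "V G \<equiv> pverts (graph_of G)"

abbreviation A :: "'a weighted_graph \<Rightarrow> 'a rel" where
  "A G \<equiv> parcs (graph_of G)"

lemma pair_graph_iff:
  "pair_graph G \<longleftrightarrow> finite (pverts G) \<and> parcs G \<subseteq> pverts G \<times> pverts G \<and>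
     sym (parcs G) \<and> irrefl (parcs G)"
proof
  assume "pair_graph G"
  then interpret pair_graph G .
  show "finite (pverts G) \<and> parcs G \<subseteq> pverts G \<times> pverts G \<and> sym (parcs G) \<and> irrefl (parcs G)"
    using pair_sym_arcs no_loops' pair_finite_verts in_arcsD1 in_arcsD2
    by (auto simp: symmetric_def irrefl_def)
next
  assume *: "finite (pverts G) \<and> parcs G \<subseteq> pverts G \<times> pverts G \<and> sym (parcs G) \<and> irrefl (parcs G)"
  then have "finite (parcs G)"
    using finite_subset by blast
  with * show "pair_graph G"
    by unfold_locales (auto simp: symmetric_def irrefl_def)
qed

lemma connected_iff_rooted:
  assumes "pair_graph G"
  shows "connected (with_proj G) \<longleftrightarrow> (\<exists>r \<in> pverts G. pverts G \<subseteq> (parcs G)\<^sup>* `` {r})"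
proof -
  interpret pair_graph G by fact
  have sym: "sym ((parcs G)\<^sup>*)"
    using assms by (simp add: pair_graph_iff sym_rtrancl)
  have "(parcs G)\<^sup>s = parcs G"
    using assms by (auto simp: pair_graph_iff symcl_def dest: symD)
  then have "connected (with_proj G) \<longleftrightarrow>
      pverts G \<noteq> {} \<and> (\<forall>u \<in> pverts G. \<forall>v \<in> pverts G. (u, v) \<in> (parcs G)\<^sup>*)"
    by (simp add: connected_conv reachable_conv' flip: reachable_def[of "with_proj G", simplified])
  also have "\<dots> \<longleftrightarrow> (\<exists>r \<in> pverts G. pverts G \<subseteq> (parcs G)\<^sup>* `` {r})" (is "?L \<longleftrightarrow> ?R")
  proof
    assume ?R
    then obtain r where r: "r \<in> pverts G" "\<And>v. v \<in> pverts G \<Longrightarrow> (r, v) \<in> (parcs G)\<^sup>*"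
      by blast
    then have "(u, v) \<in> (parcs G)\<^sup>*" if "u \<in> pverts G" "v \<in> pverts G" for u v
      using that sym by (meson rtrancl_trans symD)
    with r(1) show ?L
      by blast
  qed blast
  finally show ?thesis .
qed

lemma weighted_graph_iff:
  "weighted_graph G \<longleftrightarrow> finite (V G) \<and> A G \<subseteq> V G \<times> V G \<and> sym (A G) \<and> irrefl (A G) \<and>
     (\<exists>r \<in> V G. V G \<subseteq> (A G)\<^sup>* `` {r}) \<and> (\<forall>v \<in> V G. 0 \<le> weight G v)"
  using connected_iff_rooted[of "graph_of G"] unfolding weighted_graph_def pair_graph_iff
  by blast

lemma weighted_graph_reachable:
  assumes "weighted_graph G" "u \<in> V G" "v \<in> V G"
  shows "(u, v) \<in> (A G)\<^sup>*"
proof -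
  obtain r where "(r, u) \<in> (A G)\<^sup>*" "(r, v) \<in> (A G)\<^sup>*"
    using assms unfolding weighted_graph_iff by blast
  moreover have "sym ((A G)\<^sup>*)"
    using assms by (simp add: weighted_graph_iff sym_rtrancl)
  ultimately show ?thesis
    by (meson rtrancl_trans symD)
qed

lemma leaves_iff: "v \<in> leaves G \<longleftrightarrow> v \<in> V G \<and> (\<exists>!y. (v, y) \<in> A G)"
proof -
  have "out_arcs (with_proj (graph_of G)) v = Pair v ` {y. (v, y) \<in> A G}"
    by auto
  then have "out_degree (with_proj (graph_of G)) v = card {y. (v, y) \<in> A G}"
    by (simp add: out_degree_def card_image inj_on_def)
  then show ?thesis
    by (auto simp: leaves_def card_1_singleton_iff set_eq_iff)
qed

lemma vpath_iff:
  "vpath p (with_proj G) \<longleftrightarrow>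
     p \<noteq> [] \<and> distinct p \<and> set p \<subseteq> pverts G \<and> set (vwalk_arcs p) \<subseteq> parcs G"
  by (auto simp: vpath_def vwalk_def)

section \<open>The union of two star-convex graphs\<close>

text \<open>A vertex without neighbours would be the only vertex of a connected graph.  The leaf \<open>l\<close>
  excludes this: either \<open>v\<close> is \<open>l\<close>, or the first step of a walk from \<open>v\<close> to \<open>l\<close> is the arc
  required.\<close>

lemma has_neighbour:
  assumes "weighted_graph G" "l \<in> leaves G" "v \<in> V G"
  obtains y where "(v, y) \<in> A G"
proof (cases "v = l")
  case True
  then show ?thesis
    using assms that by (auto simp: leaves_iff)
next
  case False
  have "(v, l) \<in> (A G)\<^sup>*"
    using assms by (intro weighted_graph_reachable) (auto simp: leaves_iff)
  then show ?thesis
    using False that by (auto elim: converse_rtranclE)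
qed

text \<open>A leaf \<open>v\<close> of the larger graph is a leaf of the smaller one too: its only arc is the one that
  \<open>has_neighbour\<close> finds in \<open>G\<close>.  So the definition of the core of \<open>G\<close> provides a path to \<open>v\<close>.\<close>

lemma monotone_path_from_core_of_subgraph:
  assumes G: "star_convex G" and u: "u \<in> core G"
    and sub: "V G \<subseteq> V H" "A G \<subseteq> A H" "\<And>x. x \<in> V G \<Longrightarrow> weight H x = weight G x"
    and v: "v \<in> leaves H" "v \<in> V G"
  shows "\<exists>p. vpath p (with_proj (graph_of H)) \<and> hd p = u \<and> last p = v \<and>
           weighted_monotone (weight H) p"
proof -
  obtain y where "(v, y) \<in> A G"
    using G v(2) has_neighbour[of G] unfolding star_convex_def by blast
  then have "v \<in> leaves G"
    using v sub(2) by (auto simp: leaves_iff)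
  then obtain p where p: "vpath p (with_proj (graph_of G))" "hd p = u" "last p = v"
      "weighted_monotone (weight G) p"
    using u unfolding core_def by blast
  have "map (weight H) p = map (weight G) p"
    using p(1) sub(3) by (auto simp: vpath_iff)
  then show ?thesis
    using p sub(1,2) by (intro exI[of _ p])
        (auto simp: vpath_iff weighted_monotone_def simp del: map_eq_conv)
qed

lemma graph_union_simps [simp]:
  "V (graph_union G H) = V G \<union> V H"
  "A (graph_union G H) = A G \<union> A H"
  by (simp_all add: graph_union_def)

lemma weight_graph_union:
  assumes "weights_agree G H"
  shows "x \<in> V G \<Longrightarrow> weight (graph_union G H) x = weight G x"
    and "x \<in> V H \<Longrightarrow> weight (graph_union G H) x = weight H x"
  using assms by (auto simp: graph_union_def weights_agree_def)

lemma weighted_graph_union: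
  assumes "weighted_graph G" "weighted_graph H" "weights_agree G H" "V G \<inter> V H \<noteq> {}"
  shows "weighted_graph (graph_union G H)"
proof -
  obtain r where r: "r \<in> V G" "r \<in> V H"
    using assms(4) by blast
  have "(r, v) \<in> (A G \<union> A H)\<^sup>*" if "v \<in> V G \<union> V H" for v
    using that r assms(1,2) weighted_graph_reachable
    by (meson UnE in_rtrancl_UnI)
  then have "\<exists>r \<in> V G \<union> V H. V G \<union> V H \<subseteq> (A G \<union> A H)\<^sup>* `` {r}"
    using r by blast
  then show ?thesis
    using assms(1-3) unfolding weighted_graph_iff
    by (auto simp: weight_graph_union sym_Un irrefl_def)
qed

lemma core_inter_subset_core_union:
  assumes "star_convex G" "star_convex H" "weights_agree G H"
  shows "core G \<inter> core H \<subseteq> core (graph_union G H)"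
proof
  fix u
  assume u: "u \<in> core G \<inter> core H"
  have "\<exists>p. vpath p (with_proj (graph_of (graph_union G H))) \<and> hd p = u \<and> last p = v \<and>
          weighted_monotone (weight (graph_union G H)) p"
    if v: "v \<in> leaves (graph_union G H)" for v
  proof -
    consider "v \<in> V G" | "v \<in> V H"
      using v by (auto simp: leaves_iff)
    then show ?thesis
    proof cases
      case 1
      then show ?thesis
        using assms u v
        by (intro monotone_path_from_core_of_subgraph[of G]) (auto simp: weight_graph_union)
    next
      case 2
      then show ?thesis
        using assms u v
        by (intro monotone_path_from_core_of_subgraph[of H]) (auto simp: weight_graph_union)
    qed
  qed
  then show "u \<in> core (graph_union G H)"
    using u by (auto simp: core_def)
qed

lemma star_convex_union:
  assumes "star_convex G" "star_convex H" "weights_agree G H"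
    and "leaves (graph_union G H) \<noteq> {}" "core G \<inter> core H \<noteq> {}"
  shows "star_convex (graph_union G H)"
proof -
  have "V G \<inter> V H \<noteq> {}"
    using assms(5) by (auto simp: core_def)
  then have "weighted_graph (graph_union G H)"
    using assms by (intro weighted_graph_union) (auto simp: star_convex_def)
  then show ?thesis
    using assms core_inter_subset_core_union unfolding star_convex_def by blast
qed

section \<open>An intersection that is not star-convex\<close>

text \<open>The path \<open>0 - 1 - \<dots> - n\<close> with additional edges \<open>C\<close> and alternating weights 0, 1, 0, 1, \<dots>.
  The arcs are symmetrized, so \<open>C\<close> need only contain one orientation of each edge.\<close>

definition zigzag :: "nat \<Rightarrow> nat rel \<Rightarrow> nat weighted_graph" where
  "zigzag n C = \<lparr> graph_of = \<lparr> pverts = {..n},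
     parcs = {(i, j). i = Suc j \<and> j < n \<or> j = Suc i \<and> i < n \<or> (i, j) \<in> C \<or> (j, i) \<in> C} \<rparr>,
     weight = (\<lambda>i. of_bool (odd i)) \<rparr>"

lemma zigzag_simps [simp]:
  "V (zigzag n C) = {..n}"
  "(i, j) \<in> A (zigzag n C) \<longleftrightarrow>
     i = Suc j \<and> j < n \<or> j = Suc i \<and> i < n \<or> (i, j) \<in> C \<or> (j, i) \<in> C"
  "weight (zigzag n C) i = of_bool (odd i)"
  by (simp_all add: zigzag_def)

lemma weighted_graph_zigzag:
  assumes "C \<subseteq> {..n} \<times> {..n}" "irrefl C"
  shows "weighted_graph (zigzag n C)"
proof -
  have "(0, i) \<in> (A (zigzag n C))\<^sup>*" if "i \<le> n" for i
    using that
  proof (induction i)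
    case (Suc i)
    then have "(i, Suc i) \<in> A (zigzag n C)"
      by simp
    with Suc show ?case
      by (meson Suc_leD rtrancl.rtrancl_into_rtrancl)
  qed simp
  then have "\<exists>r \<in> V (zigzag n C). V (zigzag n C) \<subseteq> (A (zigzag n C))\<^sup>* `` {r}"
    by (intro bexI[of _ 0]) auto
  then show ?thesis
    using assms unfolding weighted_graph_iff
    by (auto intro!: symI simp: irrefl_def)
qed

text \<open>The chord gives the end \<open>n\<close> of the path a second neighbour, and inner vertices have two
  already.\<close>

lemma leaves_zigzag_chord:
  assumes "0 < c" "Suc c < n"
  shows "leaves (zigzag n {(c, n)}) = {0}"
proof -
  let ?G = "zigzag n {(c, n)}"
  have "0 \<in> leaves ?G"
    using assms by (auto simp: leaves_iff)
  moreover have "i \<notin> leaves ?G" if "0 < i" for i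
  proof (cases "i < n")
    case True
    then have "(i, i - 1) \<in> A ?G" "(i, Suc i) \<in> A ?G" "i - 1 \<noteq> Suc i"
      using that by auto
    then show ?thesis
      unfolding leaves_iff by blast
  next
    case False
    have "(n, n - 1) \<in> A ?G" "(n, c) \<in> A ?G" "n - 1 \<noteq> c"
      using assms by auto
    then have "n \<notin> leaves ?G"
      unfolding leaves_iff by blast
    with False show ?thesis
      by (cases "i = n") (auto simp: leaves_iff)
  qed
  ultimately show ?thesis
    by (auto intro: gr0I)
qed

text \<open>A leaf reaches itself by the one-vertex path.\<close>

lemma leaf_unique_in_core:
  assumes "leaves G = {v}"
  shows "v \<in> core G"
proof -
  have v: "v \<in> V G"
    using assms leaves_iff[of v G] by simp
  then have "vpath [v] (with_proj (graph_of G)) \<and> hd [v] = v \<and> last [v] = v \<and>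
      weighted_monotone (weight G) [v]"
    by (simp add: vpath_iff weighted_monotone_def)
  with v show ?thesis
    unfolding core_def assms by (simp, intro exI[of _ "[v]"]) simp
qed

lemma star_convex_unique_leaf:
  assumes "weighted_graph G" "leaves G = {v}"
  shows "star_convex G"
  using assms(1) leaf_unique_in_core[OF assms(2)] unfolding star_convex_def assms(2) by blast

text \<open>Along a walk in a path graph the parity changes at every step, so three consecutive vertices
  have weights 0, 1, 0 or 1, 0, 1.  A monotone path therefore has at most two vertices.\<close>

lemma monotone_path_zigzag_short:
  assumes "vpath p (with_proj (graph_of (zigzag n {})))"
    and "weighted_monotone (weight (zigzag n {})) p"
  shows "last p \<le> Suc (hd p) \<and> hd p \<le> Suc (last p)"
proof (cases p rule: vwalk_arcs.cases)
  case (3 x y xs)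
  show ?thesis
  proof (cases xs)
    case Nil
    then show ?thesis
      using 3 assms(1) by (auto simp: vpath_iff)
  next
    case (Cons z zs)
    with 3 have p: "p = x # y # z # zs"
      by simp
    have "odd y \<longleftrightarrow> even x" "odd z \<longleftrightarrow> even y"
      using assms(1) unfolding p by (auto simp: vpath_iff)
    then have False
      using assms(2) unfolding p weighted_monotone_def by (cases "even x") simp_all
    then show ?thesis ..
  qed
qed (use assms in \<open>auto simp: vpath_iff\<close>)

text \<open>A core vertex would be within distance 1 of both ends 0 and \<open>n\<close>.\<close>

lemma not_star_convex_zigzag:
  assumes "n \<ge> 3"
  shows "\<not> star_convex (zigzag n {})"
proof
  assume "star_convex (zigzag n {})"
  then obtain u where u: "u \<in> core (zigzag n {})"
    by (auto simp: star_convex_def)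
  have near: "v \<le> Suc u \<and> u \<le> Suc v" if v: "v \<in> leaves (zigzag n {})" for v
  proof -
    obtain p where "vpath p (with_proj (graph_of (zigzag n {})))" "hd p = u" "last p = v"
        "weighted_monotone (weight (zigzag n {})) p"
      using u v unfolding core_def by blast
    then show ?thesis
      using monotone_path_zigzag_short by metis
  qed
  have "(n, y) \<in> A (zigzag n {}) \<longleftrightarrow> y = n - 1" "(0, y) \<in> A (zigzag n {}) \<longleftrightarrow> y = 1" for y
    using assms by auto
  then have "n \<in> leaves (zigzag n {})" "0 \<in> leaves (zigzag n {})"
    by (simp_all add: leaves_iff del: zigzag_simps(2))
  then have "n \<le> Suc u" "u \<le> Suc 0"
    using near[of n] near[of 0] by simp_all
  then show False
    using assms by simp
qed

lemma graph_inter_zigzag: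
  assumes "m \<le> n" "C \<inter> A (zigzag n D) = {}" "D \<inter> A (zigzag m C) = {}"
  shows "graph_inter (zigzag m C) (zigzag n D) = zigzag m {}"
proof -
  have "A (zigzag m C) \<inter> A (zigzag n D) = A (zigzag m {})"
    using assms by fastforce
  then show ?thesis
    using assms(1) by (simp add: graph_inter_def zigzag_def Int_absorb2)
qed

lemma ex_star_convex_inter_not_star_convex:
  "\<exists>G1 G2 :: nat weighted_graph.
     star_convex G1 \<and> star_convex G2 \<and> weights_agree G1 G2 \<and>
     leaves (graph_inter G1 G2) \<noteq> {} \<and> leaves (graph_union G1 G2) \<noteq> {} \<and>
     core G1 \<inter> core G2 \<noteq> {} \<and>
     weighted_graph (graph_inter G1 G2) \<and> \<not> star_convex (graph_inter G1 G2)"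
proof -
  \<comment> \<open>Seen from the path \<open>0 - 1 - 2 - 3\<close>, the path edge \<open>3 - 4\<close> and the chord \<open>2 - 4\<close> of \<open>G2\<close>
     form a detour from 2 to 3 through the new vertex 4.\<close>
  define G1 where "G1 = zigzag 3 {(1, 3)}"
  define G2 where "G2 = zigzag 4 {(2, 4)}"
  have inter: "graph_inter G1 G2 = zigzag 3 {}"
    unfolding G1_def G2_def by (rule graph_inter_zigzag) auto
  have leaves: "leaves G1 = {0}" "leaves G2 = {0}"
    unfolding G1_def G2_def by (rule leaves_zigzag_chord; simp)+
  have wg: "weighted_graph G1" "weighted_graph G2" "weighted_graph (zigzag 3 {})"
    unfolding G1_def G2_def by (rule weighted_graph_zigzag; simp add: irrefl_def)+
  have "0 \<in> leaves (graph_inter G1 G2)" "0 \<in> leaves (graph_union G1 G2)"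
    unfolding inter by (auto simp: leaves_iff G1_def G2_def)
  then have "leaves (graph_inter G1 G2) \<noteq> {}" "leaves (graph_union G1 G2) \<noteq> {}"
    by auto
  moreover have "weights_agree G1 G2"
    by (simp add: weights_agree_def G1_def G2_def)
  moreover have "core G1 \<inter> core G2 \<noteq> {}"
    using leaves[THEN leaf_unique_in_core] by (rule ex_in_conv[THEN iffD1, OF exI, OF IntI])
  moreover have "star_convex G1" "star_convex G2"
    using star_convex_unique_leaf[OF wg(1) leaves(1)] star_convex_unique_leaf[OF wg(2) leaves(2)] .
  moreover have "weighted_graph (graph_inter G1 G2)" "\<not> star_convex (graph_inter G1 G2)"
    unfolding inter using wg(3) not_star_convex_zigzag[of 3] by simp_all
  ultimately show ?thesis
    by (intro exI[of _ G1] exI[of _ G2] conjI)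
qed

theorem proposition1p2:
  shows "(\<forall>G1 G2 :: 'a weighted_graph.
            star_convex G1 \<and> star_convex G2 \<and> weights_agree G1 G2 \<and>
            leaves (graph_inter G1 G2) \<noteq> {} \<and> leaves (graph_union G1 G2) \<noteq> {} \<and>
            core G1 \<inter> core G2 \<noteq> {}
            \<longrightarrow> star_convex (graph_union G1 G2))
       \<and> (\<exists>G1 G2 :: nat weighted_graph.
            star_convex G1 \<and> star_convex G2 \<and> weights_agree G1 G2 \<and>
            leaves (graph_inter G1 G2) \<noteq> {} \<and> leaves (graph_union G1 G2) \<noteq> {} \<and>
            core G1 \<inter> core G2 \<noteq> {} \<and>
            weighted_graph (graph_inter G1 G2) \<and> \<not> star_convex (graph_inter G1 G2))"
proof (intro conjI allI impI)
  fix G1 G2 :: "'a weighted_graph"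
  assume *: "star_convex G1 \<and> star_convex G2 \<and> weights_agree G1 G2 \<and>
      leaves (graph_inter G1 G2) \<noteq> {} \<and> leaves (graph_union G1 G2) \<noteq> {} \<and>
      core G1 \<inter> core G2 \<noteq> {}"
  show "star_convex (graph_union G1 G2)"
    by (rule star_convex_union) (simp_all add: *)
qed (rule ex_star_convex_inter_not_star_convex)

end
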